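(* Let $X\subset\mathbb{R}^s$ be an open convex set, let $f=(f_1,\dots,f_n):X\to\mathbb{R}^n$ and $g=(g_1,\dots,g_m):X\to\mathbb{R}^m$, and let $\bar x$ be a feasible point of the problem (VP): minimize $f(x)$ subject to $g(x)\leqq 0$, $x\in X$. Suppose that $f$ and the functions $g_j$, $j\in A(\bar x)$, are continuously differentiable, the functions $g_j$, $j\notin A(\bar x)$, are continuous at $\bar x$, $f$ and $g$ are second-order directionally differentiable at $\bar x$ in every critical direction $d$, all components of $f$ are second-order pseudoconvex on $X$, and all components of $g$ are quasiconvex on $X$. For $\lambda\in\mathbb{R}^n_+$, $\mu\in\mathbb{R}^m_+$ let $L=\sum_{i=1}^n\lambda_i f_i+\sum_{j=1}^m\mu_j g_j$, and consider the conditions $$\text{(a)}\quad \langle\nabla L(\bar x),d\rangle>0,$$ $$\text{(b)}\quad \nabla L(\bar x)=0,\qquad L''(\bar x,d)=\sum_{i=1}^n\lambda_i f_i''(\bar x,d)+\sum_{j\in A(\bar x)}\mu_j g_j''(\bar x,d)\geqq 0.$$ (Necessity) Let $\bar x$ be a weak Pareto minimizer. Then for every direction $d\in\mathbb{R}^s$ there exist $\lambda\in\mathbb{R}^n_+$, $\mu\in\mathbb{R}^m_+$ with $(\lambda,\mu)\neq(0,0)$ such that $\mu_j g_j(\bar x)=0$ for $j=1,\dots,m$, and such that (a) holds if $d$ is not critical, and (b) holds if $d$ is critical. If, additionally, the second-order Mangasarian-Fromovitz constraint qualification (SOMFCQ) holds at $\bar x$, then there exist a direction $d$ and multipliers $\lambda\in\mathbb{R}^n_+$,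 $\mu\in\mathbb{R}^m_+$ such that $\mu_j g_j(\bar x)=0$ for $j=1,\dots,m$, (a) holds if $d$ is not critical, (b) holds if $d$ is critical, and $\lambda\neq 0$. (Sufficiency) Conversely, suppose that for every critical direction $d\in\mathbb{R}^s$ there exist $\lambda\in\mathbb{R}^n_+$, $\mu\in\mathbb{R}^m_+$ with $\lambda\neq0$ such that $\mu_j g_j(\bar x)=0$ for $j=1,\dots,m$ and (b) is satisfied. Then $\bar x$ is a weak global Pareto minimizer of (VP).
   Context: Vector inequalities: $x<y$ means $x_i<y_i$ for all $i$; $x\leqq y$ means $x_i\leq y_i$ for all $i$. $\mathbb{R}^n_+$ is the set of vectors with non-negative components. Feasible set: $S=\{x\in X\mid g_j(x)\leq 0,\ j=1,\dots,m\}$. A point $\bar x\in S$ is a weak (global) Pareto minimizer iff there is no $x\in S$ with $f(x)<f(\bar x)$. Active set: $A(x)=\{j\in\{1,\dots,m\}\mid g_j(x)=0\}$ for $x\in S$. A direction $d\in\mathbb{R}^s$ is critical at $x\in S$ iff $\langle\nabla f_i(x),d\rangle\leq0$ for all $i=1,\dots,n$ and $\langle\nabla g_j(x),d\rangle\leq 0$ for all $j\in A(x)$. Critical directions in the claim are those critical at $\bar x$. Second-order directional derivative: for a scalar function $h:X\to\mathbb{R}$ differentiable at $x$ and $u\in\mathbb{R}^s$, $$h''(x,u)=\lim_{t\to+0}2t^{-2}[h(x+tu)-h(x)-t\langle\nabla h(x),u\rangle]\in\overline{\mathbb{R}}=\mathbb{R}\cup\{\pm\infty\}.$$ $h$ is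 second-order directionally differentiable at $x$ in direction $u$ iff this limit exists in $\overline{\mathbb{R}}$; a vector function is so iff each component is. The convention $0\cdot(\pm\infty)=0$ is used. In $\nabla L(\bar x)$, terms whose multiplier is zero are read as $0$. A scalar function $h:X\to\mathbb{R}$ on a convex set $X$ is quasiconvex iff $x,y\in X$, $h(y)\leq h(x)$, $t\in[0,1]$ imply $h((1-t)x+ty)\leq h(x)$. A scalar function $h:X\to\mathbb{R}$ that is differentiable on the open set $X$, and second-order directionally differentiable at every $x\in X$ in each direction $y-x$ such that $y\in X$, $h(y)<h(x)$, $\langle\nabla h(x),y-x\rangle=0$, is second-order pseudoconvex on $X$ iff for all $x,y\in X$: (i) $h(y)<h(x)$ implies $\langle\nabla h(x),y-x\rangle\leq0$; (ii) $h(y)<h(x)$ and $\langle\nabla h(x),y-x\rangle=0$ imply $h''(x,y-x)<0$. SOMFCQ holds at $\bar x$ iff there exist a direction $d\in\mathbb{R}^s$ and a set of indexes $K\subset A(\bar x)$ (possibly empty) such that $\langle\nabla g_j(\bar x),d\rangle=0$ and $g_j''(\bar x,d)<0$ for $j\in K$, and $\langle\nabla g_j(\bar x),d\rangle<0$ for $j\in A(\bar x)\setminus K$. *)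

theory Defs
  imports "HOL-Analysis.Analysis"
begin

text \<open>A scalar or vector function on the open set \<open>X\<close> is represented by a total function of which
  only the values on \<open>X\<close> are used: all derivatives below are taken at points of \<open>X\<close> and are local.\<close>

definition gradient :: "('a::euclidean_space \<Rightarrow> real) \<Rightarrow> 'a \<Rightarrow> 'a" where
  "gradient h x = (THE v. GDERIV h x :> v)"

definition continuously_differentiable_on :: "('a::euclidean_space \<Rightarrow> real) \<Rightarrow> 'a set \<Rightarrow> bool" where
  "continuously_differentiable_on h X \<longleftrightarrow>
     (\<forall>x\<in>X. h differentiable (at x)) \<and> continuous_on X (gradient h)"

definition so_quotient :: "('a::euclidean_space \<Rightarrow> real) \<Rightarrow> 'a \<Rightarrow> 'a \<Rightarrow> real \<Rightarrow> real" where
  "so_quotient h x u t = 2 / t\<^sup>2 * (h (x + t *\<^sub>R u) - h x - t * (gradient h x \<bullet> u))"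

text \<open>The limit is taken in the extended reals, so infinite values are admitted.
  The value \<open>so_deriv h x u\<close> is meaningful only if \<open>so_differentiable h x u\<close> holds.\<close>

definition so_differentiable :: "('a::euclidean_space \<Rightarrow> real) \<Rightarrow> 'a \<Rightarrow> 'a \<Rightarrow> bool" where
  "so_differentiable h x u \<longleftrightarrow>
     h differentiable (at x) \<and>
     (\<exists>v::ereal. ((\<lambda>t. ereal (so_quotient h x u t)) \<longlongrightarrow> v) (at_right 0))"

definition so_deriv :: "('a::euclidean_space \<Rightarrow> real) \<Rightarrow> 'a \<Rightarrow> 'a \<Rightarrow> ereal" where
  "so_deriv h x u = Lim (at_right 0) (\<lambda>t. ereal (so_quotient h x u t))"

definition quasiconvex_on :: "('a::real_vector \<Rightarrow> real) \<Rightarrow> 'a set \<Rightarrow> bool" where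
  "quasiconvex_on h X \<longleftrightarrow>
     (\<forall>x\<in>X. \<forall>y\<in>X. \<forall>t\<in>{0..1}. h y \<le> h x \<longrightarrow> h ((1 - t) *\<^sub>R x + t *\<^sub>R y) \<le> h x)"

definition so_pseudoconvex_on :: "('a::euclidean_space \<Rightarrow> real) \<Rightarrow> 'a set \<Rightarrow> bool" where
  "so_pseudoconvex_on h X \<longleftrightarrow>
     (\<forall>x\<in>X. h differentiable (at x)) \<and>
     (\<forall>x\<in>X. \<forall>y\<in>X. h y < h x \<and> gradient h x \<bullet> (y - x) = 0 \<longrightarrow> so_differentiable h x (y - x)) \<and>
     (\<forall>x\<in>X. \<forall>y\<in>X.
        (h y < h x \<longrightarrow> gradient h x \<bullet> (y - x) \<le> 0) \<and>
        (h y < h x \<and> gradient h x \<bullet> (y - x) = 0 \<longrightarrow> so_deriv h x (y - x) < 0))"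

definition feasible_set :: "'a set \<Rightarrow> ('a \<Rightarrow> real ^ 'm) \<Rightarrow> 'a set" where
  "feasible_set X g = {x \<in> X. \<forall>j. g x $ j \<le> 0}"

text \<open>Dominance is strict in every component; this is not the library relation \<open><\<close> on vectors.\<close>

definition weak_pareto_minimizer ::
    "'a set \<Rightarrow> ('a \<Rightarrow> real ^ 'n) \<Rightarrow> ('a \<Rightarrow> real ^ 'm) \<Rightarrow> 'a \<Rightarrow> bool" where
  "weak_pareto_minimizer X f g xbar \<longleftrightarrow>
     xbar \<in> feasible_set X g \<and> \<not> (\<exists>x \<in> feasible_set X g. \<forall>i. f x $ i < f xbar $ i)"

definition active_set :: "('a \<Rightarrow> real ^ 'm) \<Rightarrow> 'a \<Rightarrow> 'm set" where
  "active_set g x = {j. g x $ j = 0}"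

definition critical_direction ::
    "('a::euclidean_space \<Rightarrow> real ^ 'n) \<Rightarrow> ('a \<Rightarrow> real ^ 'm) \<Rightarrow> 'a \<Rightarrow> 'a \<Rightarrow> bool" where
  "critical_direction f g x d \<longleftrightarrow>
     (\<forall>i. gradient (\<lambda>y. f y $ i) x \<bullet> d \<le> 0) \<and>
     (\<forall>j\<in>active_set g x. gradient (\<lambda>y. g y $ j) x \<bullet> d \<le> 0)"

definition SOMFCQ :: "('a::euclidean_space \<Rightarrow> real ^ 'm) \<Rightarrow> 'a \<Rightarrow> bool" where
  "SOMFCQ g x \<longleftrightarrow>
     (\<exists>d K. K \<subseteq> active_set g x \<and>
        (\<forall>j\<in>K. gradient (\<lambda>y. g y $ j) x \<bullet> d = 0 \<and>
               so_differentiable (\<lambda>y. g y $ j) x d \<and> so_deriv (\<lambda>y. g y $ j) x d < 0) \<and>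
        (\<forall>j\<in>active_set g x - K. gradient (\<lambda>y. g y $ j) x \<bullet> d < 0))"

text \<open>A term of the Lagrangian with multiplier zero is the zero function, so it contributes nothing to
  the gradient even if the corresponding component of \<open>g\<close> is not differentiable.\<close>

definition lagrangian ::
    "('a \<Rightarrow> real ^ 'n::finite) \<Rightarrow> ('a \<Rightarrow> real ^ 'm::finite) \<Rightarrow> real ^ 'n \<Rightarrow> real ^ 'm \<Rightarrow> 'a \<Rightarrow> real" where
  "lagrangian f g lam mu x = (\<Sum>i\<in>UNIV. lam $ i * f x $ i) + (\<Sum>j\<in>UNIV. mu $ j * g x $ j)"

definition multipliers ::
    "('a \<Rightarrow> real ^ 'm) \<Rightarrow> 'a \<Rightarrow> real ^ 'n \<Rightarrow> real ^ 'm \<Rightarrow> bool" where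
  "multipliers g x lam mu \<longleftrightarrow>
     (\<forall>i. 0 \<le> lam $ i) \<and> (\<forall>j. 0 \<le> mu $ j) \<and> (\<forall>j. mu $ j * g x $ j = 0)"

definition condition_a ::
    "('a::euclidean_space \<Rightarrow> real ^ 'n::finite) \<Rightarrow> ('a \<Rightarrow> real ^ 'm::finite) \<Rightarrow> 'a \<Rightarrow> 'a \<Rightarrow>
     real ^ 'n \<Rightarrow> real ^ 'm \<Rightarrow> bool" where
  "condition_a f g x d lam mu \<longleftrightarrow> gradient (lagrangian f g lam mu) x \<bullet> d > 0"

text \<open>In \<^typ>\<open>ereal\<close> one has \<open>0 * \<plusminus>\<infinity> = 0\<close>, as wanted, but also \<open>\<infinity> + (-\<infinity>) = \<infinity>\<close>.
  The second conjunct of \<open>condition_b\<close> therefore excludes sums with terms of both infinite values: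
  an undefined sum does not satisfy the inequality.\<close>

definition condition_b ::
    "('a::euclidean_space \<Rightarrow> real ^ 'n::finite) \<Rightarrow> ('a \<Rightarrow> real ^ 'm::finite) \<Rightarrow> 'a \<Rightarrow> 'a \<Rightarrow>
     real ^ 'n \<Rightarrow> real ^ 'm \<Rightarrow> bool" where
  "condition_b f g x d lam mu \<longleftrightarrow>
     (let L = lagrangian f g lam mu;
          F = (\<lambda>i. ereal (lam $ i) * so_deriv (\<lambda>y. f y $ i) x d);
          G = (\<lambda>j. ereal (mu $ j) * so_deriv (\<lambda>y. g y $ j) x d);
          T = F ` UNIV \<union> G ` active_set g x
      in gradient L x = 0 \<and>
         \<not> (\<infinity> \<in> T \<and> -\<infinity> \<in> T) \<and>
         so_differentiable L x d \<and>
         so_deriv L x d = (\<Sum>i\<in>UNIV. F i) + (\<Sum>j\<in>active_set g x. G j) \<and>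
         so_deriv L x d \<ge> 0)"

end

theory Submission
  imports Defs
begin

text \<open>
  Write \<open>h k\<close> for the objectives and the active constraints, taken as one family, and \<open>grad k\<close> for their
  gradients at \<open>xbar\<close>.

  \<^emph>\<open>Necessity.\<close> If \<open>d\<close> is not critical, some \<open>grad k \<bullet> d\<close> is positive, and the unit multiplier at \<open>k\<close>
  gives (a). Let \<open>d\<close> be critical. Components with \<open>grad k \<bullet> d < 0\<close> improve along \<open>d\<close>, so only those
  with \<open>grad k \<bullet> d = 0\<close> matter. Generalised convexity splits them into two kinds.

  If \<open>grad k \<noteq> 0\<close>, the component cannot decrease along \<open>d\<close>: a lower value at \<open>xbar + t d\<close>
  would persist at \<open>xbar + t d + e grad k\<close>, a point in a direction of positive slope, where
  generalised convexity admits no lower value. Hence its second derivative along \<open>d\<close> is nonnegative (\<open>so_deriv_nonneg_at_regular_point\<close>). It may be infinite, but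
  \<open>-\<infinity>\<close> never occurs, so sums of such terms are defined.

  If \<open>grad k = 0\<close> and the second derivative is nonnegative, the unit multiplier at \<open>k\<close> gives (b).
  If it is negative, then \<open>h k\<close> is lower at some \<open>xbar + s d\<close>, hence at the endpoints in all nearby
  directions, and generalised convexity pulls the decrease back to \<open>xbar\<close>: the component improves
  along every direction close to \<open>d\<close> (\<open>degenerate_component_improves_nearby\<close>).

  Suppose, then, that no unit multiplier is available. A direction \<open>z\<close> with \<open>grad k \<bullet> z < 0\<close> for all
  components of the first kind would make every component improve along the ray of direction
  \<open>d + e z\<close> for small \<open>e\<close>, against weak Pareto minimality. So there is no such \<open>z\<close>, and
  Gordan's theorem gives a vanishing nonnegative combination of these gradients. All terms of its
  second-order sum are nonnegative, which is (b). Rays suffice for this argument; since \<open>e\<close>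
  is fixed before the step length, infinite second derivatives do no harm.

  \<^emph>\<open>A nonzero objective multiplier.\<close> The direction may be chosen: for \<open>d = \<nabla>f\<^sub>i(xbar)\<close>, the unit
  multiplier at \<open>f\<^sub>i\<close> satisfies (a) if \<open>d \<noteq> 0\<close> and, trivially, (b) if \<open>d = 0\<close>.

  \<^emph>\<open>Sufficiency.\<close> If \<open>x\<close> is feasible and strictly better than \<open>xbar\<close>, then \<open>d = x - xbar\<close> is critical.
  Since \<open>\<nabla>L = 0\<close> is a nonnegative combination of gradients with nonpositive slopes along \<open>d\<close>, each
  component with a positive multiplier has slope zero; so its second derivative is nonpositive for a
  constraint by quasiconvexity and negative for an objective by second-order
  pseudoconvexity. As some objective has a positive multiplier, the sum in (b) is negative.
\<close>

section \<open>Gradients\<close>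

lemma gradient_unique:
  assumes "GDERIV h x :> v"
  shows "gradient h x = v"
proof -
  have "w = v" if "GDERIV h x :> w" for w
    using has_derivative_unique[OF assms[unfolded gderiv_def] that[unfolded gderiv_def]]
    by (metis inner_commute vector_eq_rdot)
  then show ?thesis
    unfolding gradient_def using assms by blast
qed

lemma differentiable_imp_GDERIV_gradient:
  fixes h :: "'a::euclidean_space \<Rightarrow> real"
  assumes "h differentiable (at x)"
  shows "GDERIV h x :> gradient h x"
proof -
  obtain D where D: "(h has_derivative D) (at x)"
    using assms unfolding differentiable_def by blast
  have lin: "linear D"
    using D by (rule has_derivative_linear)
  have "D = (\<lambda>z. z \<bullet> adjoint D 1)"
  proof
    show "D z = z \<bullet> adjoint D 1" for z
      using adjoint_works[OF lin, of z 1] by simp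
  qed
  with D have "GDERIV h x :> adjoint D 1"
    unfolding gderiv_def by simp
  then show ?thesis
    using gradient_unique by metis
qed

lemma has_derivative_along_ray:
  fixes h :: "'a::euclidean_space \<Rightarrow> real"
  assumes "h differentiable (at x)"
  shows "((\<lambda>t. h (x + t *\<^sub>R u)) has_real_derivative (gradient h x \<bullet> u)) (at 0)"
proof -
  have h: "(h has_derivative (\<lambda>z. z \<bullet> gradient h x)) (at (x + 0 *\<^sub>R u))"
    using differentiable_imp_GDERIV_gradient[OF assms] by (simp add: gderiv_def)
  have "((\<lambda>t. x + t *\<^sub>R u) has_derivative (\<lambda>t. t *\<^sub>R u)) (at (0::real))"
    by (auto intro!: derivative_eq_intros)
  from has_derivative_compose[OF this h]
  show ?thesis
    by (simp add: has_field_derivative_def inner_commute mult_commute_abs)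
qed

lemma negative_slope_imp_descent:
  fixes h :: "'a::euclidean_space \<Rightarrow> real"
  assumes "h differentiable (at x)" and "gradient h x \<bullet> u < 0"
  shows "\<forall>\<^sub>F t in at_right 0. h (x + t *\<^sub>R u) < h x"
proof -
  obtain b where "b > 0" "\<And>t. 0 < t \<Longrightarrow> t < b \<Longrightarrow> h (x + t *\<^sub>R u) < h x"
    using DERIV_neg_dec_right[OF has_derivative_along_ray[OF assms(1)] assms(2)] by auto
  then show ?thesis
    unfolding eventually_at_right_field by blast
qed

lemma gradient_weighted_sum:
  fixes h :: "'k \<Rightarrow> 'a::euclidean_space \<Rightarrow> real"
  assumes "\<And>k. k \<in> I \<Longrightarrow> w k \<noteq> 0 \<Longrightarrow> h k differentiable (at x)"
  shows "GDERIV (\<lambda>y. \<Sum>k\<in>I. w k * h k y) x :> (\<Sum>k\<in>I. w k *\<^sub>R gradient (h k) x)"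
proof -
  have "((\<lambda>y. w k * h k y) has_derivative (\<lambda>z. z \<bullet> (w k *\<^sub>R gradient (h k) x))) (at x)"
    if "k \<in> I" for k
  proof (cases "w k = 0")
    case False
    then have "(h k has_derivative (\<lambda>z. z \<bullet> gradient (h k) x)) (at x)"
      using assms[OF that] differentiable_imp_GDERIV_gradient unfolding gderiv_def by blast
    then show ?thesis
      by (auto intro!: derivative_eq_intros)
  qed simp
  then show ?thesis
    unfolding gderiv_def inner_sum_right by (rule has_derivative_sum)
qed

section \<open>Second-order directional derivatives\<close>

lemma tendsto_so_deriv:
  assumes "so_differentiable h x u"
  shows "((\<lambda>t. ereal (so_quotient h x u t)) \<longlongrightarrow> so_deriv h x u) (at_right 0)"
proof -
  obtain v where v: "((\<lambda>t. ereal (so_quotient h x u t)) \<longlongrightarrow> v) (at_right 0)"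
    using assms unfolding so_differentiable_def by blast
  then have "so_deriv h x u = v"
    unfolding so_deriv_def by (intro tendsto_Lim) auto
  with v show ?thesis by simp
qed

lemma so_deriv_eqI:
  assumes "((\<lambda>t. ereal (so_quotient h x u t)) \<longlongrightarrow> v) (at_right 0)"
  shows "so_deriv h x u = v"
  unfolding so_deriv_def using assms by (intro tendsto_Lim) auto

lemma negative_so_deriv_imp_descent:
  assumes "so_differentiable h x u" and "gradient h x \<bullet> u = 0" and "so_deriv h x u < 0"
  shows "\<forall>\<^sub>F t in at_right 0. h (x + t *\<^sub>R u) < h x"
proof -
  have "\<forall>\<^sub>F t in at_right 0. ereal (so_quotient h x u t) < 0"
    using tendsto_so_deriv[OF assms(1)] assms(3) by (rule order_tendstoD(2))
  moreover have "\<forall>\<^sub>F t in at_right (0::real). 0 < t"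
    by (simp add: eventually_at_right_less)
  ultimately show ?thesis
  proof eventually_elim
    case (elim t)
    then have "2 / t\<^sup>2 * (h (x + t *\<^sub>R u) - h x) < 0" and "2 / t\<^sup>2 > 0"
      by (simp_all add: so_quotient_def assms(2) zero_ereal_def)
    then have "h (x + t *\<^sub>R u) - h x < 0"
      by (meson mult_less_0_iff not_less_iff_gr_or_eq)
    then show ?case by simp
  qed
qed

lemma so_deriv_nonpos_if_nonincreasing:
  assumes "so_differentiable h x u" and "gradient h x \<bullet> u = 0"
    and "\<forall>\<^sub>F t in at_right 0. h (x + t *\<^sub>R u) \<le> h x"
  shows "so_deriv h x u \<le> 0"
proof (rule tendsto_upperbound[OF tendsto_so_deriv[OF assms(1)]])
  show "\<forall>\<^sub>F t in at_right 0. ereal (so_quotient h x u t) \<le> 0"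
    using assms(3)
  proof eventually_elim
    case (elim t)
    then show ?case
      by (simp add: so_quotient_def assms(2) zero_ereal_def divide_nonpos_nonneg)
  qed
qed simp

lemma tendsto_sum_ereal_nonneg:
  fixes q :: "'k \<Rightarrow> 'b \<Rightarrow> ereal"
  assumes "finite I" and "\<And>k. k \<in> I \<Longrightarrow> (q k \<longlongrightarrow> v k) F" and "\<And>k. k \<in> I \<Longrightarrow> 0 \<le> v k"
  shows "((\<lambda>t. \<Sum>k\<in>I. q k t) \<longlongrightarrow> (\<Sum>k\<in>I. v k)) F"
  using assms
proof (induction I rule: finite_induct)
  case (insert k J)
  have "0 \<le> (\<Sum>k\<in>J. v k)"
    using insert.prems by (intro sum_nonneg) auto
  moreover have "0 \<le> v k"
    using insert.prems by simp
  ultimately have "v k \<noteq> - \<infinity>" "(\<Sum>k\<in>J. v k) \<noteq> - \<infinity>"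
    by auto
  with insert show ?case
    by (simp add: tendsto_add_ereal_nonneg)
qed simp

text \<open>Limits in the extended reals add up here because no summand tends to \<open>-\<infinity>\<close>. A term with weight
  zero contributes nothing on either side, whether or not its function is differentiable.\<close>

lemma so_deriv_weighted_sum:
  fixes h :: "'k \<Rightarrow> 'a::euclidean_space \<Rightarrow> real"
  assumes "finite I" and "\<And>k. k \<in> I \<Longrightarrow> 0 \<le> w k"
    and "\<And>k. k \<in> I \<Longrightarrow> w k \<noteq> 0 \<Longrightarrow> so_differentiable (h k) x u"
    and "\<And>k. k \<in> I \<Longrightarrow> w k \<noteq> 0 \<Longrightarrow> 0 \<le> so_deriv (h k) x u"
  defines "L \<equiv> \<lambda>y. \<Sum>k\<in>I. w k * h k y"
  shows "so_differentiable L x u"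
    and "so_deriv L x u = (\<Sum>k\<in>I. ereal (w k) * so_deriv (h k) x u)"
proof -
  let ?q = "\<lambda>k t. ereal (w k * so_quotient (h k) x u t)"
  let ?v = "\<lambda>k. ereal (w k) * so_deriv (h k) x u"
  have diff: "h k differentiable (at x)" if "k \<in> I" "w k \<noteq> 0" for k
    using assms(3)[OF that] by (simp add: so_differentiable_def)
  have GL: "GDERIV L x :> (\<Sum>k\<in>I. w k *\<^sub>R gradient (h k) x)"
    unfolding L_def by (rule gradient_weighted_sum[OF diff])
  have qL: "ereal (so_quotient L x u t) = (\<Sum>k\<in>I. ?q k t)" for t
    unfolding so_quotient_def gradient_unique[OF GL] unfolding L_def
    by (simp add: inner_sum_left sum_distrib_left sum_subtractf[symmetric] algebra_simps)
  have lim: "(?q k \<longlongrightarrow> ?v k) (at_right 0)" if "k \<in> I" for k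
  proof (cases "w k = 0")
    case False
    have "((\<lambda>t. ereal (w k) * ereal (so_quotient (h k) x u t)) \<longlongrightarrow> ?v k) (at_right 0)"
      by (rule tendsto_cmult_ereal) (use tendsto_so_deriv[OF assms(3)[OF that False]] in auto)
    then show ?thesis by simp
  qed (simp add: zero_ereal_def[symmetric])
  have nonneg: "0 \<le> ?v k" if "k \<in> I" for k
    using assms(2,4)[OF that] by (cases "w k = 0") (auto simp: zero_ereal_def[symmetric])
  have "((\<lambda>t. \<Sum>k\<in>I. ?q k t) \<longlongrightarrow> (\<Sum>k\<in>I. ?v k)) (at_right 0)"
    by (rule tendsto_sum_ereal_nonneg[OF assms(1) lim nonneg])
  then have L: "((\<lambda>t. ereal (so_quotient L x u t)) \<longlongrightarrow> (\<Sum>k\<in>I. ?v k)) (at_right 0)"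
    by (simp only: qL)
  have "L differentiable (at x)"
    using GL unfolding gderiv_def differentiable_def by blast
  with L show "so_differentiable L x u"
    unfolding so_differentiable_def by blast
  show "so_deriv L x u = (\<Sum>k\<in>I. ?v k)"
    using L by (rule so_deriv_eqI)
qed

section \<open>Generalised convexity\<close>

text \<open>Generalised convexity speaks of the segment to a given point, whereas improvement is wanted along
  a given direction; the two differ by a change of the parameter.\<close>

lemma eventually_ray_rescale:
  fixes x u :: "'a::real_vector" and s :: real
  assumes "0 < s" and "\<forall>\<^sub>F t in at_right (0::real). P (x + t *\<^sub>R (s *\<^sub>R u))"
  shows "\<forall>\<^sub>F t in at_right (0::real). P (x + t *\<^sub>R u)"
proof -
  obtain b where b: "b > 0" "\<And>t. 0 < t \<Longrightarrow> t < b \<Longrightarrow> P (x + t *\<^sub>R (s *\<^sub>R u))"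
    using assms(2) unfolding eventually_at_right_field by auto
  have "P (x + t *\<^sub>R u)" if "0 < t" "t < b * s" for t
    using b(2)[of "t / s"] that assms(1) by (simp add: field_simps)
  then show ?thesis
    unfolding eventually_at_right_field using b(1) assms(1) by (metis mult_pos_pos)
qed

lemma quasiconvex_on_segment:
  assumes "quasiconvex_on h X" "x \<in> X" "y \<in> X" "h y \<le> h x"
  shows "\<forall>\<^sub>F t in at_right 0. h (x + t *\<^sub>R (y - x)) \<le> h x"
proof -
  have "h (x + t *\<^sub>R (y - x)) \<le> h x" if "0 < t" "t < 1" for t
  proof -
    have "h ((1 - t) *\<^sub>R x + t *\<^sub>R y) \<le> h x"
      using assms that unfolding quasiconvex_on_def by simp
    then show ?thesis
      by (simp add: algebra_simps)
  qed
  then show ?thesis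
    unfolding eventually_at_right_field by (intro exI[of _ 1]) auto
qed

lemma quasiconvex_gradient_nonpos:
  fixes h :: "'a::euclidean_space \<Rightarrow> real"
  assumes "quasiconvex_on h X" "x \<in> X" "y \<in> X" "h y \<le> h x" and "h differentiable (at x)"
  shows "gradient h x \<bullet> (y - x) \<le> 0"
proof (rule ccontr)
  assume "\<not> ?thesis"
  then have pos: "0 < gradient h x \<bullet> (y - x)" by simp
  obtain b where "b > 0" "\<And>t. 0 < t \<Longrightarrow> t < b \<Longrightarrow> h x < h (x + t *\<^sub>R (y - x))"
    using DERIV_pos_inc_right[OF has_derivative_along_ray[OF assms(5)] pos] by auto
  then have "\<forall>\<^sub>F t in at_right 0. h x < h (x + t *\<^sub>R (y - x))"
    unfolding eventually_at_right_field by blast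
  with quasiconvex_on_segment[OF assms(1-4)]
  have "\<forall>\<^sub>F t::real in at_right 0. False"
    by eventually_elim simp
  then show False by simp
qed

text \<open>A strictly negative second derivative along \<open>u\<close> produces a point of lower value in the direction
  \<open>u\<close>, which is orthogonal to the gradient. By continuity the value stays lower after a small move
  along the gradient; but the slope towards the moved point is positive, which \<open>lower\<close> forbids.\<close>

lemma so_deriv_nonneg_at_regular_point:
  fixes h :: "'a::euclidean_space \<Rightarrow> real"
  assumes "open X" "x \<in> X" "continuous_on X h"
    and lower: "\<And>y. y \<in> X \<Longrightarrow> h y < h x \<Longrightarrow> gradient h x \<bullet> (y - x) \<le> 0"
    and "gradient h x \<noteq> 0" "gradient h x \<bullet> u = 0" "so_differentiable h x u"
  shows "0 \<le> so_deriv h x u"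
proof (rule ccontr)
  assume "\<not> ?thesis"
  then have "\<forall>\<^sub>F t in at_right 0. h (x + t *\<^sub>R u) < h x"
    using negative_so_deriv_imp_descent assms(6,7) by (metis not_le)
  moreover have "\<forall>\<^sub>F t in at_right 0. x + t *\<^sub>R u \<in> X"
  proof (rule topological_tendstoD[OF _ assms(1)])
    show "((\<lambda>t. x + t *\<^sub>R u) \<longlongrightarrow> x) (at_right (0::real))"
      by (auto intro!: tendsto_eq_intros)
  qed (fact assms(2))
  ultimately have "\<forall>\<^sub>F t in at_right (0::real). h (x + t *\<^sub>R u) < h x \<and> x + t *\<^sub>R u \<in> X"
    by eventually_elim simp
  then obtain t where t: "h (x + t *\<^sub>R u) < h x" "x + t *\<^sub>R u \<in> X"
    using eventually_happens'[OF trivial_limit_at_right_real] by blast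
  define y where "y = (\<lambda>e. x + t *\<^sub>R u + e *\<^sub>R gradient h x)"
  have y: "(y \<longlongrightarrow> x + t *\<^sub>R u) (at_right (0::real))"
    unfolding y_def by (auto intro!: tendsto_eq_intros)
  have "isCont h (x + t *\<^sub>R u)"
    using assms(1,3) t(2) by (simp add: continuous_on_eq_continuous_at)
  then have "((\<lambda>e. h (y e)) \<longlongrightarrow> h (x + t *\<^sub>R u)) (at_right 0)"
    using y by (rule isCont_tendsto_compose)
  then have "\<forall>\<^sub>F e in at_right 0. h (y e) < h x"
    using t(1) by (rule order_tendstoD(2))
  moreover have "\<forall>\<^sub>F e in at_right 0. y e \<in> X"
    using topological_tendstoD[OF y assms(1) t(2)] .
  moreover have "\<forall>\<^sub>F e in at_right (0::real). 0 < e"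
    by (simp add: eventually_at_right_less)
  ultimately have "\<forall>\<^sub>F e::real in at_right 0. False"
  proof eventually_elim
    case (elim e)
    have "gradient h x \<bullet> (y e - x) = e * (gradient h x \<bullet> gradient h x)"
      by (simp add: y_def inner_add_right assms(6))
    also have "\<dots> > 0"
      using elim(3) assms(5) by simp
    finally show ?case
      using lower[OF elim(2,1)] by simp
  qed
  then show False by simp
qed

section \<open>A theorem of the alternative\<close>

text \<open>Gordan's theorem: if \<open>0\<close> were outside the convex hull of the vectors, a separating hyperplane would
  yield a solution \<open>z\<close>. The coefficients of \<open>0\<close> in the hull are the weights.\<close>

lemma Gordan_alternative:
  fixes v :: "'k \<Rightarrow> 'a::euclidean_space"
  assumes "finite I" and "\<nexists>z. \<forall>k\<in>I. v k \<bullet> z < 0"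
  obtains w :: "'k \<Rightarrow> real" where "\<And>k. 0 \<le> w k" "\<And>k. k \<notin> I \<Longrightarrow> w k = 0"
    "\<exists>k. w k \<noteq> 0" "(\<Sum>k\<in>I. w k *\<^sub>R v k) = 0"
proof -
  have "0 \<in> convex hull (v ` I)"
  proof (rule ccontr)
    assume "0 \<notin> convex hull (v ` I)"
    moreover have "closed (convex hull (v ` I))"
      using assms(1) by (simp add: finite_imp_compact_convex_hull compact_imp_closed)
    ultimately obtain a b where ab: "0 < b" "\<forall>y\<in>convex hull (v ` I). a \<bullet> y > b"
      using separating_hyperplane_closed_0[OF convex_convex_hull] by blast
    have "v k \<bullet> (- a) < 0" if "k \<in> I" for k
    proof -
      have "v k \<in> convex hull (v ` I)"
        using that by (simp add: hull_inc)
      then show ?thesis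
        using ab by (force simp: inner_commute)
    qed
    with assms(2) show False by blast
  qed
  then obtain c where c: "\<forall>y\<in>v ` I. 0 \<le> c y" "sum c (v ` I) = 1" "(\<Sum>y\<in>v ` I. c y *\<^sub>R y) = 0"
    using assms(1) by (auto simp: convex_hull_finite)
  \<comment> \<open>Several indices may carry the same vector; its coefficient goes to one of them.\<close>
  define R where "R = inv_into I v ` v ` I"
  define w where "w = (\<lambda>k. if k \<in> R then c (v k) else 0)"
  have R: "R \<subseteq> I"
    unfolding R_def by (auto simp: inv_into_into)
  have reindex: "(\<Sum>k\<in>R. p (v k)) = (\<Sum>y\<in>v ` I. p y)" for p :: "'a \<Rightarrow> 'b::comm_monoid_add"
    unfolding R_def
    by (subst sum.reindex) (auto intro!: inj_on_inv_into sum.cong simp: f_inv_into_f)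
  have "(\<Sum>k\<in>I. w k *\<^sub>R v k) = (\<Sum>k\<in>R. c (v k) *\<^sub>R v k)"
    unfolding w_def using R assms(1) by (intro sum.mono_neutral_cong_right) auto
  then have zero: "(\<Sum>k\<in>I. w k *\<^sub>R v k) = 0"
    using reindex[of "\<lambda>y. c y *\<^sub>R y"] c(3) by simp
  have "sum w R = 1"
    using reindex[of c] c(2) by (simp add: w_def)
  then have "\<exists>k. w k \<noteq> 0"
    by (metis sum.neutral zero_neq_one)
  moreover have "0 \<le> w k" for k
    using c(1) R by (auto simp: w_def)
  moreover have "w k = 0" if "k \<notin> I" for k
    using that R by (auto simp: w_def)
  ultimately show ?thesis
    using zero that by blast
qed

section \<open>Objectives and active constraints as one family\<close>

primrec component ::
    "('a \<Rightarrow> real ^ 'n) \<Rightarrow> ('a \<Rightarrow> real ^ 'm) \<Rightarrow> 'n + 'm \<Rightarrow> 'a \<Rightarrow> real" where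
  "component f g (Inl i) = (\<lambda>y. f y $ i)"
| "component f g (Inr j) = (\<lambda>y. g y $ j)"

primrec stack :: "real ^ 'n \<Rightarrow> real ^ 'm \<Rightarrow> 'n + 'm \<Rightarrow> real" where
  "stack lam mu (Inl i) = lam $ i"
| "stack lam mu (Inr j) = mu $ j"

definition active_components :: "('a \<Rightarrow> real ^ 'm) \<Rightarrow> 'a \<Rightarrow> ('n + 'm) set" where
  "active_components g x = range Inl \<union> Inr ` active_set g x"

lemma ball_active_components:
  "(\<forall>k\<in>active_components g x. P k) \<longleftrightarrow> (\<forall>i. P (Inl i)) \<and> (\<forall>j\<in>active_set g x. P (Inr j))"
  by (auto simp: active_components_def)

lemma image_active_components:
  "p ` active_components g x = range (\<lambda>i. p (Inl i)) \<union> (\<lambda>j. p (Inr j)) ` active_set g x"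
  by (auto simp: active_components_def)

lemma sum_active_components:
  fixes p :: "'n::finite + 'm::finite \<Rightarrow> 'b::comm_monoid_add"
  shows "(\<Sum>k\<in>active_components g x. p k) =
    (\<Sum>i\<in>UNIV. p (Inl i)) + (\<Sum>j\<in>active_set g x. p (Inr j))"
  unfolding active_components_def
  by (subst sum.union_disjoint) (auto simp: sum.reindex inj_on_def)

lemma finite_active_components [simp]:
  "finite (active_components g x :: ('n::finite + 'm::finite) set)"
  by simp

text \<open>By complementarity only active constraints carry a positive multiplier, so the inactive ones,
  which need not be differentiable, drop out of the Lagrangian as a function.\<close>

lemma lagrangian_eq_sum_active:
  fixes f :: "'a \<Rightarrow> real ^ 'n" and g :: "'a \<Rightarrow> real ^ 'm"
  assumes "multipliers g x lam mu"
  shows "lagrangian f g lam mu =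
    (\<lambda>y. \<Sum>k\<in>active_components g x. stack lam mu k * component f g k y)"
proof
  fix y
  have "mu $ j = 0" if "j \<notin> active_set g x" for j
    using assms that by (auto simp: multipliers_def active_set_def)
  then have "(\<Sum>j\<in>UNIV. mu $ j * g y $ j) = (\<Sum>j\<in>active_set g x. mu $ j * g y $ j)"
    by (intro sum.mono_neutral_right) auto
  then show "lagrangian f g lam mu y =
      (\<Sum>k\<in>active_components g x. stack lam mu k * component f g k y)"
    by (simp add: lagrangian_def sum_active_components)
qed

lemma condition_b_iff_active:
  fixes f :: "'a::euclidean_space \<Rightarrow> real ^ 'n" and g :: "'a \<Rightarrow> real ^ 'm" and x d :: 'a
    and lam :: "real ^ 'n" and mu :: "real ^ 'm"
  defines "H \<equiv> \<lambda>k. ereal (stack lam mu k) * so_deriv (component f g k) x d"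
  shows "condition_b f g x d lam mu \<longleftrightarrow>
    gradient (lagrangian f g lam mu) x = 0 \<and>
    \<not> (\<infinity> \<in> H ` active_components g x \<and> - \<infinity> \<in> H ` active_components g x) \<and>
    so_differentiable (lagrangian f g lam mu) x d \<and>
    so_deriv (lagrangian f g lam mu) x d = (\<Sum>k\<in>active_components g x. H k) \<and>
    0 \<le> so_deriv (lagrangian f g lam mu) x d"
  unfolding condition_b_def H_def image_active_components sum_active_components Let_def by simp

lemma gradient_lagrangian:
  fixes f :: "'a::euclidean_space \<Rightarrow> real ^ 'n" and g :: "'a \<Rightarrow> real ^ 'm"
  assumes "multipliers g x lam mu"
    and "\<And>k. k \<in> active_components g x \<Longrightarrow> component f g k differentiable (at x)"
  shows "gradient (lagrangian f g lam mu) x =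
    (\<Sum>k\<in>active_components g x. stack lam mu k *\<^sub>R gradient (component f g k) x)"
  unfolding lagrangian_eq_sum_active[OF assms(1)]
  by (rule gradient_unique, rule gradient_weighted_sum, rule assms(2))

lemma condition_b_if_nonneg_terms:
  fixes f :: "'a::euclidean_space \<Rightarrow> real ^ 'n" and g :: "'a \<Rightarrow> real ^ 'm"
  assumes "multipliers g x lam mu"
    and "gradient (lagrangian f g lam mu) x = 0"
    and "\<And>k. k \<in> active_components g x \<Longrightarrow> stack lam mu k \<noteq> 0 \<Longrightarrow>
           so_differentiable (component f g k) x d \<and> 0 \<le> so_deriv (component f g k) x d"
  shows "condition_b f g x d lam mu"
proof -
  let ?A = "active_components g x :: ('n + 'm) set"
  have nonneg: "0 \<le> stack lam mu k" for k
    using assms(1) by (cases k) (auto simp: multipliers_def)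
  have terms: "0 \<le> ereal (stack lam mu k) * so_deriv (component f g k) x d" if "k \<in> ?A" for k
    using assms(3)[OF that] nonneg[of k]
    by (cases "stack lam mu k = 0") (auto simp: zero_ereal_def[symmetric])
  have L: "so_differentiable (lagrangian f g lam mu) x d"
    "so_deriv (lagrangian f g lam mu) x d =
       (\<Sum>k\<in>?A. ereal (stack lam mu k) * so_deriv (component f g k) x d)"
    unfolding lagrangian_eq_sum_active[OF assms(1)]
    using so_deriv_weighted_sum[where I = ?A and w = "stack lam mu" and h = "component f g"
        and x = x and u = d] nonneg assms(3) by auto
  have "- \<infinity> \<notin> (\<lambda>k. ereal (stack lam mu k) * so_deriv (component f g k) x d) ` ?A"
  proof
    assume "- \<infinity> \<in> (\<lambda>k. ereal (stack lam mu k) * so_deriv (component f g k) x d) ` ?A"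
    then obtain k where k: "k \<in> ?A"
      and "- \<infinity> = ereal (stack lam mu k) * so_deriv (component f g k) x d"
      by (rule imageE)
    then have "0 \<le> (- \<infinity> :: ereal)"
      using terms[OF k] by (simp only:)
    then show False by simp
  qed
  moreover have "0 \<le> so_deriv (lagrangian f g lam mu) x d"
    unfolding L(2) by (intro sum_nonneg terms)
  ultimately show ?thesis
    unfolding condition_b_iff_active using assms(2) L by simp
qed

section \<open>The vector problem\<close>

locale quasiconvex_vector_problem =
  fixes X :: "'a::euclidean_space set"
    and f :: "'a \<Rightarrow> real ^ 'n"
    and g :: "'a \<Rightarrow> real ^ 'm"
    and xbar :: 'a
  assumes X_open: "open X"
    and xbar_feasible: "xbar \<in> feasible_set X g"
    and g_active_differentiable:
      "\<And>j x. j \<in> active_set g xbar \<Longrightarrow> x \<in> X \<Longrightarrow> (\<lambda>y. g y $ j) differentiable (at x)"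
    and g_inactive_continuous: "\<And>j. j \<notin> active_set g xbar \<Longrightarrow> isCont (\<lambda>y. g y $ j) xbar"
    and f_so_differentiable:
      "\<And>d i. critical_direction f g xbar d \<Longrightarrow> so_differentiable (\<lambda>y. f y $ i) xbar d"
    and g_active_so_differentiable:
      "\<And>d j. critical_direction f g xbar d \<Longrightarrow> j \<in> active_set g xbar \<Longrightarrow>
         so_differentiable (\<lambda>y. g y $ j) xbar d"
    and f_so_pseudoconvex: "\<And>i. so_pseudoconvex_on (\<lambda>y. f y $ i) X"
    and g_quasiconvex: "\<And>j. quasiconvex_on (\<lambda>y. g y $ j) X"
begin

abbreviation h :: "'n + 'm \<Rightarrow> 'a \<Rightarrow> real" where
  "h \<equiv> component f g"

abbreviation A :: "('n + 'm) set" where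
  "A \<equiv> active_components g xbar"

abbreviation grad :: "'n + 'm \<Rightarrow> 'a" where
  "grad k \<equiv> gradient (h k) xbar"

lemma xbar_in_X: "xbar \<in> X"
  using xbar_feasible by (simp add: feasible_set_def)

lemma h_differentiable:
  assumes "k \<in> A" "x \<in> X"
  shows "h k differentiable (at x)"
  using assms g_active_differentiable f_so_pseudoconvex
  by (auto simp: active_components_def so_pseudoconvex_on_def)

lemma h_so_differentiable:
  assumes "critical_direction f g xbar d" "k \<in> A"
  shows "so_differentiable (h k) xbar d"
  using assms f_so_differentiable g_active_so_differentiable
  by (auto simp: active_components_def)

lemma h_continuous:
  assumes "k \<in> A"
  shows "continuous_on X (h k)"
  using h_differentiable[OF assms] X_open
  by (meson continuous_at_imp_continuous_on differentiable_imp_continuous_within)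

text \<open>The first-order property that both generalised convexity notions share.\<close>

lemma h_lower_imp_gradient_nonpos:
  assumes "k \<in> A" "y \<in> X" "h k y < h k xbar"
  shows "grad k \<bullet> (y - xbar) \<le> 0"
proof (cases k)
  case (Inl i)
  then show ?thesis
    using f_so_pseudoconvex[of i] xbar_in_X assms(2,3) by (auto simp: so_pseudoconvex_on_def)
next
  case (Inr j)
  then show ?thesis
    using quasiconvex_gradient_nonpos[OF g_quasiconvex[of j] xbar_in_X assms(2)] assms(3)
      h_differentiable[OF assms(1) xbar_in_X] by simp
qed

lemma critical_direction_iff: "critical_direction f g xbar d \<longleftrightarrow> (\<forall>k\<in>A. grad k \<bullet> d \<le> 0)"
  by (simp add: critical_direction_def ball_active_components)

lemma eventually_ray_in_X: "\<forall>\<^sub>F t in at_right (0::real). xbar + t *\<^sub>R u \<in> X"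
  by (rule topological_tendstoD[OF _ X_open xbar_in_X]) (auto intro!: tendsto_eq_intros)

text \<open>Objectives must decrease strictly, but an active constraint only has to stay satisfied. The weaker
  requirement on constraints is what quasiconvexity can deliver.\<close>

primrec improves :: "'n + 'm \<Rightarrow> 'a \<Rightarrow> bool" where
  "improves (Inl i) y \<longleftrightarrow> f y $ i < f xbar $ i"
| "improves (Inr j) y \<longleftrightarrow> g y $ j \<le> 0"

lemma improves_if_less:
  assumes "k \<in> A" "h k y < h k xbar"
  shows "improves k y"
  using assms by (auto simp: active_components_def active_set_def)

lemma no_common_improvement:
  assumes "weak_pareto_minimizer X f g xbar"
  shows "\<not> (\<forall>k\<in>A. \<forall>\<^sub>F t in at_right 0. improves k (xbar + t *\<^sub>R u))"
proof
  assume improve: "\<forall>k\<in>A. \<forall>\<^sub>F t in at_right 0. improves k (xbar + t *\<^sub>R u)"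
  have inactive: "\<forall>\<^sub>F t in at_right 0. g (xbar + t *\<^sub>R u) $ j \<le> 0" if "j \<notin> active_set g xbar" for j
  proof -
    have "((\<lambda>t. g (xbar + t *\<^sub>R u) $ j) \<longlongrightarrow> g xbar $ j) (at_right 0)"
      by (rule isCont_tendsto_compose[OF g_inactive_continuous[OF that]])
        (auto intro!: tendsto_eq_intros)
    moreover have "g xbar $ j < 0"
      using xbar_feasible that by (auto simp: feasible_set_def active_set_def order_less_le)
    ultimately have "\<forall>\<^sub>F t in at_right 0. g (xbar + t *\<^sub>R u) $ j < 0"
      by (rule order_tendstoD(2))
    then show ?thesis
      by eventually_elim simp
  qed
  have "\<forall>\<^sub>F t in at_right 0. \<forall>i. f (xbar + t *\<^sub>R u) $ i < f xbar $ i"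
    using improve by (intro eventually_all_finite) (simp add: ball_active_components)
  moreover have "\<forall>\<^sub>F t in at_right 0. \<forall>j. g (xbar + t *\<^sub>R u) $ j \<le> 0"
    using improve inactive by (intro eventually_all_finite) (auto simp: ball_active_components)
  ultimately have "\<forall>\<^sub>F t::real in at_right 0. False"
    using eventually_ray_in_X[of u]
  proof eventually_elim
    case (elim t)
    then show ?case
      using assms by (auto simp: weak_pareto_minimizer_def feasible_set_def)
  qed
  then show False by simp
qed

text \<open>The decrease at \<open>xbar + s d\<close> survives a small change of \<open>d\<close> by continuity. From the perturbed point it
  is carried back to \<open>xbar\<close>: for a constraint by quasiconvexity along the segment; for an objective
  by second-order pseudoconvexity, which makes the second derivative towards that point negative
  because the slope vanishes.\<close>

lemma degenerate_component_improves_nearby: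
  assumes k: "k \<in> A" "grad k = 0"
    and d: "so_differentiable (h k) xbar d" "so_deriv (h k) xbar d < 0"
  shows "\<forall>\<^sub>F e in at_right 0. \<forall>\<^sub>F t in at_right 0. improves k (xbar + t *\<^sub>R (d + e *\<^sub>R z))"
proof -
  have "\<forall>\<^sub>F s in at_right (0::real). 0 < s \<and> xbar + s *\<^sub>R d \<in> X \<and> h k (xbar + s *\<^sub>R d) < h k xbar"
    using eventually_at_right_less eventually_ray_in_X
      negative_so_deriv_imp_descent[OF d(1) _ d(2)] k(2) by (intro eventually_conj) auto
  then obtain s where s: "0 < s" "xbar + s *\<^sub>R d \<in> X" "h k (xbar + s *\<^sub>R d) < h k xbar"
    using eventually_happens'[OF trivial_limit_at_right_real] by blast
  define y where "y = (\<lambda>e. xbar + s *\<^sub>R (d + e *\<^sub>R z))"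
  have y: "(y \<longlongrightarrow> xbar + s *\<^sub>R d) (at_right (0::real))"
    unfolding y_def by (auto intro!: tendsto_eq_intros)
  have "isCont (h k) (xbar + s *\<^sub>R d)"
    using h_continuous[OF k(1)] X_open s(2) by (simp add: continuous_on_eq_continuous_at)
  then have "((\<lambda>e. h k (y e)) \<longlongrightarrow> h k (xbar + s *\<^sub>R d)) (at_right 0)"
    using y by (rule isCont_tendsto_compose)
  then have "\<forall>\<^sub>F e in at_right 0. h k (y e) < h k xbar"
    using s(3) by (rule order_tendstoD(2))
  moreover have "\<forall>\<^sub>F e in at_right 0. y e \<in> X"
    using topological_tendstoD[OF y X_open s(2)] .
  ultimately show ?thesis
  proof eventually_elim
    case (elim e)
    have "\<forall>\<^sub>F t in at_right 0. improves k (xbar + t *\<^sub>R (y e - xbar))"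
    proof (cases k)
      case (Inl i)
      have "so_differentiable (h k) xbar (y e - xbar)" "so_deriv (h k) xbar (y e - xbar) < 0"
        using f_so_pseudoconvex[of i] xbar_in_X elim k(2) Inl
        by (auto simp: so_pseudoconvex_on_def)
      then have "\<forall>\<^sub>F t in at_right 0. h k (xbar + t *\<^sub>R (y e - xbar)) < h k xbar"
        using negative_so_deriv_imp_descent k(2) by force
      then show ?thesis
        by eventually_elim (rule improves_if_less[OF k(1)])
    next
      case (Inr j)
      then have "g xbar $ j = 0"
        using k(1) by (auto simp: active_components_def active_set_def)
      then show ?thesis
        using quasiconvex_on_segment[OF g_quasiconvex[of j] xbar_in_X elim(2)] elim(1) Inr by simp
    qed
    then have "\<forall>\<^sub>F t in at_right 0. improves k (xbar + t *\<^sub>R (s *\<^sub>R (d + e *\<^sub>R z)))"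
      by (simp add: y_def)
    then show ?case
      by (rule eventually_ray_rescale[OF s(1)])
  qed
qed

lemma obtain_multipliers:
  assumes "\<And>k. 0 \<le> w k" "\<And>k. k \<notin> A \<Longrightarrow> w k = 0"
  obtains lam mu where "multipliers g xbar lam mu" "stack lam mu = w"
proof
  let ?lam = "\<chi> i. w (Inl i)" and ?mu = "\<chi> j. w (Inr j)"
  show "stack ?lam ?mu = w"
    by (rule ext) (rename_tac k, case_tac k; simp)
  show "multipliers g xbar ?lam ?mu"
    using assms by (auto simp: multipliers_def active_components_def active_set_def image_iff)
qed

lemma stack_nonzero:
  assumes "stack lam mu k \<noteq> 0"
  shows "(lam, mu) \<noteq> (0, 0)"
  using assms by (cases k) auto

lemma necessary_condition_noncritical:
  assumes "\<not> critical_direction f g xbar d"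
  shows "\<exists>lam mu. multipliers g xbar lam mu \<and> (lam, mu) \<noteq> (0, 0) \<and> condition_a f g xbar d lam mu"
proof -
  obtain k where k: "k \<in> A" "0 < grad k \<bullet> d"
    using assms by (auto simp: critical_direction_iff not_le)
  obtain lam mu where m: "multipliers g xbar lam mu" "stack lam mu = (\<lambda>l. if l = k then 1 else 0)"
    by (rule obtain_multipliers[of "\<lambda>l. if l = k then 1 else 0"]) (use k(1) in auto)
  have "gradient (lagrangian f g lam mu) xbar = grad k"
    using gradient_lagrangian[OF m(1) h_differentiable[OF _ xbar_in_X]] k(1)
    by (simp add: m(2) if_distrib[of "\<lambda>c. c *\<^sub>R _"] cong: if_cong)
  with k(2) have "condition_a f g xbar d lam mu"
    by (simp add: condition_a_def)
  moreover have "stack lam mu k \<noteq> 0"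
    using m(2) by simp
  ultimately show ?thesis
    using m(1) stack_nonzero by blast
qed

text \<open>Either a component with vanishing gradient and nonnegative second derivative takes all the weight,
  or Gordan's theorem applies to the set \<open>N\<close> of components with zero slope along \<open>d\<close> and nonzero
  gradient. A solution \<open>z\<close> of Gordan's strict system would let all components improve along
  \<open>d + e z\<close>: those with negative slope along \<open>d\<close> and the degenerate ones because \<open>e\<close> is small, those
  in \<open>N\<close> because their slope along \<open>d + e z\<close> is \<open>e\<close> times that along \<open>z\<close>.\<close>

lemma critical_multiplier_weights:
  assumes "weak_pareto_minimizer X f g xbar" and crit: "critical_direction f g xbar d"
  obtains w where "\<And>k. 0 \<le> w k" "\<And>k. k \<notin> A \<Longrightarrow> w k = 0" "\<exists>k. w k \<noteq> 0"
    "(\<Sum>k\<in>A. w k *\<^sub>R grad k) = 0"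
    "\<And>k. k \<in> A \<Longrightarrow> w k \<noteq> 0 \<Longrightarrow> 0 \<le> so_deriv (h k) xbar d"
proof (cases "\<exists>k\<in>A. grad k = 0 \<and> 0 \<le> so_deriv (h k) xbar d")
  case True
  then obtain k where k: "k \<in> A" "grad k = 0" "0 \<le> so_deriv (h k) xbar d"
    by blast
  have "(\<Sum>l\<in>A. (if l = k then 1 else 0) *\<^sub>R grad l) = 0"
    using k(2) by (intro sum.neutral) auto
  with k show ?thesis
    by (intro that[of "\<lambda>l. if l = k then 1 else 0"]) (auto split: if_splits)
next
  case degenerate: False
  define N where "N = {k \<in> A. grad k \<bullet> d = 0 \<and> grad k \<noteq> 0}"
  have so_nonneg: "0 \<le> so_deriv (h k) xbar d" if "k \<in> N" for k
    using that X_open xbar_in_X h_continuous h_so_differentiable[OF crit] h_lower_imp_gradient_nonpos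
    by (intro so_deriv_nonneg_at_regular_point[where X = X]) (auto simp: N_def)
  have "\<nexists>z. \<forall>k\<in>N. grad k \<bullet> z < 0"
  proof
    assume "\<exists>z. \<forall>k\<in>N. grad k \<bullet> z < 0"
    then obtain z where z: "\<And>k. k \<in> N \<Longrightarrow> grad k \<bullet> z < 0" by blast
    have slope: "\<forall>\<^sub>F t in at_right 0. improves k (xbar + t *\<^sub>R u)" if "k \<in> A" "grad k \<bullet> u < 0" for k u
      using negative_slope_imp_descent[OF h_differentiable[OF that(1) xbar_in_X] that(2)]
      by eventually_elim (rule improves_if_less[OF that(1)])
    have "\<forall>\<^sub>F e in at_right 0. \<forall>\<^sub>F t in at_right 0. improves k (xbar + t *\<^sub>R (d + e *\<^sub>R z))"
      if k: "k \<in> A" for k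
    proof -
      consider "grad k \<bullet> d < 0" | "k \<in> N" | "grad k = 0"
        using crit k unfolding critical_direction_iff N_def by force
      then show ?thesis
      proof cases
        case 1
        have "((\<lambda>e. grad k \<bullet> (d + e *\<^sub>R z)) \<longlongrightarrow> grad k \<bullet> d) (at_right (0::real))"
          by (auto intro!: tendsto_eq_intros)
        then have "\<forall>\<^sub>F e in at_right 0. grad k \<bullet> (d + e *\<^sub>R z) < 0"
          using 1 by (rule order_tendstoD(2))
        then show ?thesis
          by eventually_elim (rule slope[OF k])
      next
        case 2
        have "\<forall>\<^sub>F e in at_right (0::real). 0 < e"
          by (simp add: eventually_at_right_less)
        then show ?thesis
        proof eventually_elim
          case (elim e)
          have "grad k \<bullet> (d + e *\<^sub>R z) < 0"
            using 2 z[OF 2] elim by (simp add: N_def inner_add_right mult_pos_neg)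
          then show ?case by (rule slope[OF k])
        qed
      next
        case 3
        then show ?thesis
          using degenerate k h_so_differentiable[OF crit k]
          by (intro degenerate_component_improves_nearby) (auto simp: not_le)
      qed
    qed
    then have "\<forall>\<^sub>F e in at_right 0. \<forall>k\<in>A. \<forall>\<^sub>F t in at_right 0. improves k (xbar + t *\<^sub>R (d + e *\<^sub>R z))"
      by (intro eventually_ball_finite) auto
    then show False
      using no_common_improvement[OF assms(1)] by simp
  qed
  from Gordan_alternative[OF finite this]
  obtain w where w: "\<And>k. 0 \<le> w k" "\<And>k. k \<notin> N \<Longrightarrow> w k = 0" "\<exists>k. w k \<noteq> 0"
    "(\<Sum>k\<in>N. w k *\<^sub>R grad k) = 0"
    by blast
  have "N \<subseteq> A" by (auto simp: N_def)
  then have "(\<Sum>k\<in>A. w k *\<^sub>R grad k) = (\<Sum>k\<in>N. w k *\<^sub>R grad k)"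
    using w(2) by (intro sum.mono_neutral_right) auto
  then show ?thesis
    using w \<open>N \<subseteq> A\<close> so_nonneg by (intro that[of w]) auto
qed

lemma necessary_condition_critical:
  assumes "weak_pareto_minimizer X f g xbar" and crit: "critical_direction f g xbar d"
  shows "\<exists>lam mu. multipliers g xbar lam mu \<and> (lam, mu) \<noteq> (0, 0) \<and> condition_b f g xbar d lam mu"
proof -
  obtain w where w: "\<And>k. 0 \<le> w k" "\<And>k. k \<notin> A \<Longrightarrow> w k = 0" "\<exists>k. w k \<noteq> 0"
    "(\<Sum>k\<in>A. w k *\<^sub>R grad k) = 0"
    "\<And>k. k \<in> A \<Longrightarrow> w k \<noteq> 0 \<Longrightarrow> 0 \<le> so_deriv (h k) xbar d"
    using critical_multiplier_weights[OF assms] by blast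
  obtain lam mu where m: "multipliers g xbar lam mu" "stack lam mu = w"
    using obtain_multipliers[of w] w(1,2) by blast
  have "gradient (lagrangian f g lam mu) xbar = 0"
    using gradient_lagrangian[OF m(1) h_differentiable[OF _ xbar_in_X]] w(4) m(2) by simp
  then have "condition_b f g xbar d lam mu"
    using condition_b_if_nonneg_terms[OF m(1)] w(5) h_so_differentiable[OF crit] m(2) by blast
  then show ?thesis
    using m w(3) stack_nonzero[of lam mu] by auto
qed

text \<open>The gradient of an objective is itself a suitable direction. It is critical only if it vanishes, and
  along the zero direction all second derivatives are zero.\<close>

lemma objective_multiplier_exists:
  "\<exists>d lam mu. multipliers g xbar lam mu \<and> lam \<noteq> 0 \<and>
     (\<not> critical_direction f g xbar d \<longrightarrow> condition_a f g xbar d lam mu) \<and>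
     (critical_direction f g xbar d \<longrightarrow> condition_b f g xbar d lam mu)"
proof -
  fix i :: 'n
  define k where "k = (Inl i :: 'n + 'm)"
  define d where "d = grad k"
  have k: "k \<in> A"
    by (simp add: k_def active_components_def)
  obtain lam mu where m: "multipliers g xbar lam mu" "stack lam mu = (\<lambda>l. if l = k then 1 else 0)"
    by (rule obtain_multipliers[of "\<lambda>l. if l = k then 1 else 0"]) (use k in auto)
  have gL: "gradient (lagrangian f g lam mu) xbar = d"
    using gradient_lagrangian[OF m(1) h_differentiable[OF _ xbar_in_X]] k
    by (simp add: m(2) d_def if_distrib[of "\<lambda>c. c *\<^sub>R _"] cong: if_cong)
  have "lam $ i = 1"
    using fun_cong[OF m(2), of k] by (simp add: k_def)
  then have "lam \<noteq> 0" by auto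
  moreover have "condition_a f g xbar d lam mu" if "\<not> critical_direction f g xbar d"
  proof -
    have "d \<noteq> 0"
      using that by (auto simp: critical_direction_def)
    then show ?thesis
      by (simp add: condition_a_def gL)
  qed
  moreover have "condition_b f g xbar d lam mu" if "critical_direction f g xbar d"
  proof (rule condition_b_if_nonneg_terms[OF m(1)])
    have "d \<bullet> d \<le> 0"
      using that k by (auto simp: critical_direction_iff d_def)
    then have "d = 0"
      using inner_gt_zero_iff[of d] by linarith
    then show "gradient (lagrangian f g lam mu) xbar = 0"
      using gL by simp
    show "so_differentiable (h l) xbar d \<and> 0 \<le> so_deriv (h l) xbar d" if l: "l \<in> A" for l
    proof
      show "so_differentiable (h l) xbar d"
        using h_so_differentiable \<open>critical_direction f g xbar d\<close> l by blast
      have "so_deriv (h l) xbar d = 0"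
        unfolding \<open>d = 0\<close> by (rule so_deriv_eqI) (simp add: so_quotient_def zero_ereal_def)
      then show "0 \<le> so_deriv (h l) xbar d" by simp
    qed
  qed
  ultimately show ?thesis
    using m(1) by blast
qed

text \<open>Towards a feasible point that is better in all objectives, every second-order term of the Lagrangian
  is nonpositive, and a term with positive objective multiplier is negative.\<close>

lemma sufficient_condition:
  assumes "\<And>d. critical_direction f g xbar d \<Longrightarrow>
    \<exists>lam mu. multipliers g xbar lam mu \<and> lam \<noteq> 0 \<and> condition_b f g xbar d lam mu"
  shows "weak_pareto_minimizer X f g xbar"
proof (rule ccontr)
  assume "\<not> ?thesis"
  then obtain x where x: "x \<in> X" "\<And>j. g x $ j \<le> 0" "\<And>i. f x $ i < f xbar $ i"
    using xbar_feasible by (auto simp: weak_pareto_minimizer_def feasible_set_def)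
  define d where "d = x - xbar"
  have slope: "grad k \<bullet> d \<le> 0" if "k \<in> A" for k
  proof (cases k)
    case (Inl i)
    then show ?thesis
      using h_lower_imp_gradient_nonpos[OF that x(1)] x(3) by (simp add: d_def)
  next
    case (Inr j)
    then have "g xbar $ j = 0"
      using that by (auto simp: active_components_def active_set_def)
    then show ?thesis
      using quasiconvex_gradient_nonpos[OF g_quasiconvex[of j] xbar_in_X x(1)] x(2)
        h_differentiable[OF that xbar_in_X] Inr by (simp add: d_def)
  qed
  then have crit: "critical_direction f g xbar d"
    by (simp add: critical_direction_iff)
  then obtain lam mu where m: "multipliers g xbar lam mu" "lam \<noteq> 0"
    and b: "condition_b f g xbar d lam mu"
    using assms by blast
  let ?w = "stack lam mu"
  let ?H = "\<lambda>k. ereal (?w k) * so_deriv (h k) xbar d"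
  have w: "0 \<le> ?w k" for k
    using m(1) by (cases k) (auto simp: multipliers_def)
  have "(\<Sum>k\<in>A. ?w k *\<^sub>R grad k) = 0"
    using b gradient_lagrangian[OF m(1) h_differentiable[OF _ xbar_in_X]]
    by (simp add: condition_b_iff_active)
  then have "(\<Sum>k\<in>A. ?w k * (grad k \<bullet> d)) = 0"
    by (metis (no_types, lifting) inner_scaleR_left inner_sum_left inner_zero_left sum.cong)
  then have "(\<Sum>k\<in>A. - (?w k * (grad k \<bullet> d))) = 0"
    by (simp add: sum_negf)
  then have "\<forall>k\<in>A. - (?w k * (grad k \<bullet> d)) = 0"
    using w slope by (subst (asm) sum_nonneg_eq_0_iff) (auto simp: mult_nonneg_nonpos)
  then have flat: "grad k \<bullet> d = 0" if "k \<in> A" "?w k \<noteq> 0" for k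
    using that by auto
  have f_neg: "so_deriv (h (Inl i)) xbar d < 0" if "?w (Inl i) \<noteq> 0" for i
    using f_so_pseudoconvex[of i] xbar_in_X x(1,3) flat[OF _ that]
    by (auto simp: so_pseudoconvex_on_def d_def active_components_def)
  have nonpos: "?H k \<le> 0" if k: "k \<in> A" for k
  proof (cases "?w k = 0")
    case False
    have "so_deriv (h k) xbar d \<le> 0"
    proof (cases k)
      case (Inl i)
      then show ?thesis
        using f_neg[of i] False by simp
    next
      case (Inr j)
      then have "g xbar $ j = 0"
        using k by (auto simp: active_components_def active_set_def)
      then show ?thesis
        using quasiconvex_on_segment[OF g_quasiconvex[of j] xbar_in_X x(1)] x(2) Inr
        by (intro so_deriv_nonpos_if_nonincreasing h_so_differentiable[OF crit k] flat[OF k False])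
          (simp add: d_def)
    qed
    then show ?thesis
      using w[of k] by (simp add: ereal_mult_le_0_iff)
  qed (simp add: zero_ereal_def[symmetric])
  obtain i where i: "lam $ i \<noteq> 0"
    using m(2) by (metis vec_eq_iff zero_index)
  have iA: "Inl i \<in> A"
    by (simp add: active_components_def)
  have "?H (Inl i) < 0"
    using f_neg[of i] i w[of "Inl i"] by (simp add: ereal_mult_less_0_iff)
  moreover have "(\<Sum>k\<in>A - {Inl i}. ?H k) \<le> 0"
    using nonpos by (intro sum_nonpos) auto
  ultimately have "(\<Sum>k\<in>A. ?H k) < 0"
    using iA by (subst sum.remove[of _ "Inl i"])
      (auto simp: add_neg_nonpos intro: le_less_trans[OF add_left_mono])
  moreover have "so_deriv (lagrangian f g lam mu) xbar d = (\<Sum>k\<in>A. ?H k)"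
    and "0 \<le> so_deriv (lagrangian f g lam mu) xbar d"
    using b unfolding condition_b_iff_active by blast+
  ultimately show False
    by simp
qed

end

theorem theorem1:
  fixes X :: "(real ^ 's) set"
    and f :: "real ^ 's \<Rightarrow> real ^ 'n"
    and g :: "real ^ 's \<Rightarrow> real ^ 'm"
    and xbar :: "real ^ 's"
  assumes "open X" and "convex X"
    and "xbar \<in> feasible_set X g"
    and "\<And>i. continuously_differentiable_on (\<lambda>x. f x $ i) X"
    and "\<And>j. j \<in> active_set g xbar \<Longrightarrow> continuously_differentiable_on (\<lambda>x. g x $ j) X"
    and "\<And>j. j \<notin> active_set g xbar \<Longrightarrow> isCont (\<lambda>x. g x $ j) xbar"
    and "\<And>d i. critical_direction f g xbar d \<Longrightarrow> so_differentiable (\<lambda>x. f x $ i) xbar d"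
    \<comment> \<open>inactive constraints need not be differentiable at \<open>xbar\<close>; the notion applies only if they are\<close>
    and "\<And>d j. critical_direction f g xbar d \<Longrightarrow> (\<lambda>x. g x $ j) differentiable (at xbar)
           \<Longrightarrow> so_differentiable (\<lambda>x. g x $ j) xbar d"
    and "\<And>i. so_pseudoconvex_on (\<lambda>x. f x $ i) X"
    and "\<And>j. quasiconvex_on (\<lambda>x. g x $ j) X"
  shows
    "(weak_pareto_minimizer X f g xbar \<longrightarrow>
        (\<forall>d. \<exists>lam mu. multipliers g xbar lam mu \<and> (lam, mu) \<noteq> (0, 0) \<and>
           (\<not> critical_direction f g xbar d \<longrightarrow> condition_a f g xbar d lam mu) \<and>
           (critical_direction f g xbar d \<longrightarrow> condition_b f g xbar d lam mu))) \<and>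
     (weak_pareto_minimizer X f g xbar \<and> SOMFCQ g xbar \<longrightarrow>
        (\<exists>d lam mu. multipliers g xbar lam mu \<and> lam \<noteq> 0 \<and>
           (\<not> critical_direction f g xbar d \<longrightarrow> condition_a f g xbar d lam mu) \<and>
           (critical_direction f g xbar d \<longrightarrow> condition_b f g xbar d lam mu))) \<and>
     ((\<forall>d. critical_direction f g xbar d \<longrightarrow>
          (\<exists>lam mu. multipliers g xbar lam mu \<and> lam \<noteq> 0 \<and> condition_b f g xbar d lam mu)) \<longrightarrow>
        weak_pareto_minimizer X f g xbar)"
proof -
  interpret quasiconvex_vector_problem X f g xbar
  proof
    fix j x
    assume "j \<in> active_set g xbar" "x \<in> X"
    then show "(\<lambda>y. g y $ j) differentiable (at x)"
      using assms(5) by (simp add: continuously_differentiable_on_def)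
  next
    fix d j
    assume "critical_direction f g xbar d" "j \<in> active_set g xbar"
    moreover have "xbar \<in> X"
      using assms(3) by (simp add: feasible_set_def)
    ultimately show "so_differentiable (\<lambda>y. g y $ j) xbar d"
      using assms(5,8) by (simp add: continuously_differentiable_on_def)
  qed (use assms in auto)
  show ?thesis
    using necessary_condition_noncritical necessary_condition_critical
      objective_multiplier_exists sufficient_condition
    by blast
qed

end
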